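(* Let $M,N$ be terms of the extended stack calculus. If $M$ and $N$ are separable, then $M\not\simeq N$.
   Context: The extended stack calculus. Stack variables $\alpha,\beta,\gamma,\ldots$. Stacks $\pi ::= \mathsf{nil}\mid\alpha\mid\mathsf{cdr}(\pi)\mid M::\pi$; terms $M ::= \mathsf{car}(\pi)\mid\mu\alpha.M\mid M\star\pi$ ($\star$ left-associative with precedence over $\mu$; $::$ right-associative, binding tighter than $\star$; $\mu\vec\alpha.M\star\vec\pi$ abbreviates $\mu\alpha_1\ldots\mu\alpha_n.(M\star\pi_1\star\cdots\star\pi_m)$). $E\{\pi/\alpha\}$ is capture-avoiding substitution. Reduction rules: $(\mu\alpha.M)\star\pi\to M\{\pi/\alpha\}$, $\mathsf{car}(M::\pi)\to M$, $\mathsf{cdr}(M::\pi)\to\pi$; $=_s$ is the equivalence closure of their contextual closure. $\mathsf{cdr}^n$ is $n$-fold $\mathsf{cdr}$, $\mathsf{car}_n(\pi):=\mathsf{car}(\mathsf{cdr}^n(\pi))$. Canonical form: normal form w.r.t. the $\mathsf{car},\mathsf{cdr}$ rules. Head reduction: $M\to_h\mu\vec\alpha.N\{\varpi/\beta\}\star\vec\pi$ if $\mu\vec\alpha.(\mu\beta.N)\star\varpi\star\vec\pi$ is the canonical form of $M$ (no contextual closure). Hnf: non-$\to_h$-reducible term $\mu\vec\alpha.H\star\vec\pi$, proper if $H=\mathsf{car}_n(\beta)$, improper if $H=\mathsf{car}_n(\mathsf{nil})$. Head contexts: $C[\cdot]::=[\cdot]\mid C[\cdot]\star\pi\mid\mu\alpha.C[\cdot]$.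 $M\simeq N$ iff for every head context $C$, $C[M]$ $\to_h$-reduces to a proper hnf iff $C[N]$ does. Let $\mathbf T:=\mu\alpha.\mathsf{car}_0(\alpha)\star\mathsf{cdr}^2(\alpha)$ and $\mathbf F:=\mu\alpha.\mathsf{car}_1(\alpha)\star\mathsf{cdr}^2(\alpha)$. $M$ and $N$ are separable if there is a head context $C[\cdot]$ with $C[M]=_s\mathbf T$ and $C[N]=_s\mathbf F$. *)

theory Defs
  imports Main
begin

section \<open>The extended stack calculus\<close>

text \<open>
  Terms and stacks are taken up to renaming of bound variables, by means of de Bruijn indices:
  the stack variables are the natural numbers, and \<open>\<mu> M\<close> binds index \<open>0\<close> in \<open>M\<close>.
  The stack constructor \<open>::\<close> is written \<open>:::\<close>.
\<close>

datatype stk =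
    NilS
  | Var nat
  | Cdr stk
  | ConsS trm stk  (infixr ":::" 75)
and trm =
    Car stk
  | Mu trm
  | App trm stk  (infixl "\<star>" 70)

definition up_ren :: "(nat \<Rightarrow> nat) \<Rightarrow> nat \<Rightarrow> nat" where
  "up_ren r = case_nat 0 (Suc \<circ> r)"

primrec ren_s :: "(nat \<Rightarrow> nat) \<Rightarrow> stk \<Rightarrow> stk" and ren_t :: "(nat \<Rightarrow> nat) \<Rightarrow> trm \<Rightarrow> trm" where
  "ren_s r NilS = NilS"
| "ren_s r (Var i) = Var (r i)"
| "ren_s r (Cdr p) = Cdr (ren_s r p)"
| "ren_s r (M ::: p) = ren_t r M ::: ren_s r p"
| "ren_t r (Car p) = Car (ren_s r p)"
| "ren_t r (Mu M) = Mu (ren_t (up_ren r) M)"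
| "ren_t r (M \<star> p) = ren_t r M \<star> ren_s r p"

definition up_sub :: "(nat \<Rightarrow> stk) \<Rightarrow> nat \<Rightarrow> stk" where
  "up_sub s = case_nat (Var 0) (ren_s Suc \<circ> s)"

primrec sub_s :: "(nat \<Rightarrow> stk) \<Rightarrow> stk \<Rightarrow> stk" and sub_t :: "(nat \<Rightarrow> stk) \<Rightarrow> trm \<Rightarrow> trm" where
  "sub_s s NilS = NilS"
| "sub_s s (Var i) = s i"
| "sub_s s (Cdr p) = Cdr (sub_s s p)"
| "sub_s s (M ::: p) = sub_t s M ::: sub_s s p"
| "sub_t s (Car p) = Car (sub_s s p)"
| "sub_t s (Mu M) = Mu (sub_t (up_sub s) M)"
| "sub_t s (M \<star> p) = sub_t s M \<star> sub_s s p"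

text \<open>\<open>inst M p\<close> is \<open>M{p/\<alpha>}\<close>, where \<open>\<alpha>\<close> is the variable bound by the outer binder of \<open>Mu M\<close>.\<close>

definition inst :: "trm \<Rightarrow> stk \<Rightarrow> trm" where
  "inst M p = sub_t (case_nat p Var) M"

text \<open>
  \<open>mu a M\<close> is the abstraction of the free variable \<open>a\<close> of \<open>M\<close>, that is, the usual \<open>\<mu>a. M\<close> with
  a named variable \<open>a\<close>; every other free variable of \<open>M\<close> keeps its name.
\<close>

definition mu :: "nat \<Rightarrow> trm \<Rightarrow> trm" where
  "mu a M = Mu (ren_t (\<lambda>i. if i = a then 0 else Suc i) M)"

subsection \<open>Reduction\<close>

inductive cctx_s :: "(stk \<Rightarrow> stk \<Rightarrow> bool) \<Rightarrow> (trm \<Rightarrow> trm \<Rightarrow> bool) \<Rightarrow> stk \<Rightarrow> stk \<Rightarrow> bool"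
  and cctx_t :: "(stk \<Rightarrow> stk \<Rightarrow> bool) \<Rightarrow> (trm \<Rightarrow> trm \<Rightarrow> bool) \<Rightarrow> trm \<Rightarrow> trm \<Rightarrow> bool"
  for S :: "stk \<Rightarrow> stk \<Rightarrow> bool" and R :: "trm \<Rightarrow> trm \<Rightarrow> bool"
where
  root_s: "S p p' \<Longrightarrow> cctx_s S R p p'"
| cdr: "cctx_s S R p p' \<Longrightarrow> cctx_s S R (Cdr p) (Cdr p')"
| cons_l: "cctx_t S R M M' \<Longrightarrow> cctx_s S R (M ::: p) (M' ::: p)"
| cons_r: "cctx_s S R p p' \<Longrightarrow> cctx_s S R (M ::: p) (M ::: p')"
| root_t: "R M M' \<Longrightarrow> cctx_t S R M M'"
| car: "cctx_s S R p p' \<Longrightarrow> cctx_t S R (Car p) (Car p')"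
| mu: "cctx_t S R M M' \<Longrightarrow> cctx_t S R (Mu M) (Mu M')"
| app_l: "cctx_t S R M M' \<Longrightarrow> cctx_t S R (M \<star> p) (M' \<star> p)"
| app_r: "cctx_s S R p p' \<Longrightarrow> cctx_t S R (M \<star> p) (M \<star> p')"

inductive cdr_rule :: "stk \<Rightarrow> stk \<Rightarrow> bool" where
  "cdr_rule (Cdr (M ::: p)) p"

inductive car_rule :: "trm \<Rightarrow> trm \<Rightarrow> bool" where
  "car_rule (Car (M ::: p)) M"

inductive mu_rule :: "trm \<Rightarrow> trm \<Rightarrow> bool" where
  "mu_rule (Mu M \<star> p) (inst M p)"

definition red :: "trm \<Rightarrow> trm \<Rightarrow> bool" where
  "red = cctx_t cdr_rule (sup mu_rule car_rule)"

definition eq_s :: "trm \<Rightarrow> trm \<Rightarrow> bool"  (infix "=\<^sub>s" 50) where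
  "M =\<^sub>s N \<longleftrightarrow> equivclp red M N"

subsection \<open>Canonical forms and head reduction\<close>

definition can_red :: "trm \<Rightarrow> trm \<Rightarrow> bool" where
  "can_red = cctx_t cdr_rule car_rule"

text \<open>\<open>can_form M P\<close>: \<open>P\<close> is the canonical form of \<open>M\<close>.\<close>

definition can_form :: "trm \<Rightarrow> trm \<Rightarrow> bool" where
  "can_form M P \<longleftrightarrow> can_red\<^sup>*\<^sup>* M P \<and> (\<nexists>Q. can_red P Q)"

definition mus :: "nat \<Rightarrow> trm \<Rightarrow> trm" where
  "mus k M = (Mu ^^ k) M"

definition apps :: "trm \<Rightarrow> stk list \<Rightarrow> trm" where
  "apps M ps = foldl App M ps"

definition car_n :: "nat \<Rightarrow> stk \<Rightarrow> trm" where
  "car_n n p = Car ((Cdr ^^ n) p)"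

inductive head_red :: "trm \<Rightarrow> trm \<Rightarrow> bool"  (infix "\<rightarrow>\<^sub>h" 50) where
  "can_form M (mus k (apps (Mu N \<star> w) ps)) \<Longrightarrow> M \<rightarrow>\<^sub>h mus k (apps (inst N w) ps)"

text \<open>
  Head normal forms, like head reduction itself, are read modulo the car and cdr rules: the
  shape \<open>\<mu>\<alpha>\<^sub>1 \<dots> \<mu>\<alpha>\<^sub>k. H \<star> \<pi>\<^sub>1 \<star> \<dots> \<star> \<pi>\<^sub>m\<close> is the shape of the canonical form. A head reduct need not be
  canonical, and a car redex in head position is not contracted by \<open>\<rightarrow>\<^sub>h\<close> alone.
\<close>

definition hnf :: "trm \<Rightarrow> bool" where
  "hnf M \<longleftrightarrow> (\<nexists>M'. M \<rightarrow>\<^sub>h M')"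

definition proper_hnf :: "trm \<Rightarrow> bool" where
  "proper_hnf M \<longleftrightarrow> hnf M \<and> (\<exists>k n b ps. can_form M (mus k (apps (car_n n (Var b)) ps)))"

subsection \<open>Head contexts, observational equivalence and separability\<close>

text \<open>Filling the hole may capture: the binder of \<open>CMu a C\<close> binds the free variable \<open>a\<close> of the filler.\<close>

datatype head_ctx =
    Hole
  | CApp head_ctx stk
  | CMu nat head_ctx

primrec fill :: "head_ctx \<Rightarrow> trm \<Rightarrow> trm" where
  "fill Hole M = M"
| "fill (CApp C p) M = fill C M \<star> p"
| "fill (CMu a C) M = mu a (fill C M)"

definition obs_eq :: "trm \<Rightarrow> trm \<Rightarrow> bool"  (infix "\<simeq>" 50) where
  "M \<simeq> N \<longleftrightarrow> (\<forall>C. (\<exists>P. head_red\<^sup>*\<^sup>* (fill C M) P \<and> proper_hnf P) \<longleftrightarrow>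
                   (\<exists>P. head_red\<^sup>*\<^sup>* (fill C N) P \<and> proper_hnf P))"

definition TT :: trm where
  "TT = Mu (car_n 0 (Var 0) \<star> (Cdr ^^ 2) (Var 0))"

definition FF :: trm where
  "FF = Mu (car_n 1 (Var 0) \<star> (Cdr ^^ 2) (Var 0))"

definition separable :: "trm \<Rightarrow> trm \<Rightarrow> bool" where
  "separable M N \<longleftrightarrow> (\<exists>C. fill C M =\<^sub>s TT \<and> fill C N =\<^sub>s FF)"

end

theory Submission
  imports Defs
begin

text \<open>
  The proof avoids confluence and standardization by means of a graph model. A type is either the
  ground type or an arrow whose source is a finite set of requirements on the components of a
  stack; a term denotes a set of types and a stack denotes an infinite sequence of such sets, with
  \<open>nil\<close> denoting the empty sets. The denotation is invariant under \<open>=\<^sub>s\<close>. A realizability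
  argument shows that a term of ground type head reduces to a proper head normal form, and
  conversely every term with a proper head normal form has some type. Applying the two members of a
  separated pair to the stack \<open>car(\<alpha>) :: car(nil) :: nil\<close> yields a term of ground type and a term
  without any type.
\<close>

section \<open>Substitution\<close>

lemma up_ren_simps [simp]: "up_ren r 0 = 0" "up_ren r (Suc i) = Suc (r i)"
  by (simp_all add: up_ren_def)

lemma up_sub_simps [simp]: "up_sub s 0 = Var 0" "up_sub s (Suc i) = ren_s Suc (s i)"
  by (simp_all add: up_sub_def)

lemma up_ren_comp: "up_ren r \<circ> up_ren r' = up_ren (r \<circ> r')"
  by (rule ext) (simp add: up_ren_def split: nat.split)

lemma up_sub_comp_up_ren: "up_sub s \<circ> up_ren r = up_sub (s \<circ> r)"
  by (rule ext) (simp add: up_ren_def up_sub_def split: nat.split)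

lemma up_sub_Var: "up_sub Var = Var"
  by (rule ext) (simp add: up_sub_def split: nat.split)

lemma sub_Var:
  shows "sub_s Var p = p" and "sub_t Var M = M"
  by (induction p and M) (simp_all add: up_sub_Var)

lemma ren_ren:
  shows "ren_s r (ren_s r' p) = ren_s (r \<circ> r') p" and "ren_t r (ren_t r' M) = ren_t (r \<circ> r') M"
  by (induction p and M arbitrary: r r' and r r') (simp_all add: up_ren_comp)

lemma sub_ren:
  shows "sub_s s (ren_s r p) = sub_s (s \<circ> r) p" and "sub_t s (ren_t r M) = sub_t (s \<circ> r) M"
  by (induction p and M arbitrary: s r and s r) (simp_all add: up_sub_comp_up_ren)

lemma ren_comp_up_sub: "ren_s (up_ren r) \<circ> up_sub s = up_sub (ren_s r \<circ> s)"
proof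
  fix i
  show "(ren_s (up_ren r) \<circ> up_sub s) i = up_sub (ren_s r \<circ> s) i"
    by (cases i) (simp_all add: ren_ren comp_def)
qed

lemma ren_sub:
  shows "ren_s r (sub_s s p) = sub_s (ren_s r \<circ> s) p" and "ren_t r (sub_t s M) = sub_t (ren_s r \<circ> s) M"
  by (induction p and M arbitrary: s r and s r) (simp_all add: ren_comp_up_sub)

lemma sub_comp_up_sub: "sub_s (up_sub s) \<circ> up_sub s' = up_sub (sub_s s \<circ> s')"
proof
  fix i
  show "(sub_s (up_sub s) \<circ> up_sub s') i = up_sub (sub_s s \<circ> s') i"
    by (cases i) (simp_all add: sub_ren ren_sub comp_def)
qed

lemma sub_sub:
  shows "sub_s s (sub_s s' p) = sub_s (sub_s s \<circ> s') p"
    and "sub_t s (sub_t s' M) = sub_t (sub_s s \<circ> s') M"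
  by (induction p and M arbitrary: s s' and s s') (simp_all add: sub_comp_up_sub)

text \<open>Collapses a closing substitution followed by a beta step into one substitution; the
  \<open>Mu\<close> case of the realizability argument relies on it.\<close>

lemma inst_sub_up: "inst (sub_t (up_sub s) M) p = sub_t (case_nat p s) M"
proof -
  have "sub_s (case_nat p Var) \<circ> up_sub s = case_nat p s"
  proof
    fix i
    show "(sub_s (case_nat p Var) \<circ> up_sub s) i = case_nat p s i"
      by (cases i) (simp_all add: sub_ren comp_def sub_Var)
  qed
  then show ?thesis
    by (simp add: inst_def sub_sub)
qed

section \<open>Canonical forms\<close>

fun can_cdr :: "stk \<Rightarrow> stk" where
  "can_cdr (M ::: p) = p"
| "can_cdr p = Cdr p"

fun can_car :: "stk \<Rightarrow> trm" where
  "can_car (M ::: p) = M"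
| "can_car p = Car p"

text \<open>One bottom-up pass suffices: contracting a root redex exposes a component of an already
  canonical stack, so no further redex arises.\<close>

primrec can_s :: "stk \<Rightarrow> stk" and can_t :: "trm \<Rightarrow> trm" where
  "can_s NilS = NilS"
| "can_s (Var i) = Var i"
| "can_s (Cdr p) = can_cdr (can_s p)"
| "can_s (M ::: p) = can_t M ::: can_s p"
| "can_t (Car p) = can_car (can_s p)"
| "can_t (Mu M) = Mu (can_t M)"
| "can_t (M \<star> p) = can_t M \<star> can_s p"

abbreviation can_red_s :: "stk \<Rightarrow> stk \<Rightarrow> bool" where
  "can_red_s \<equiv> cctx_s cdr_rule car_rule"

lemma rtranclp_map:
  assumes "\<And>x y. r x y \<Longrightarrow> q (f x) (f y)" and "r\<^sup>*\<^sup>* x y"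
  shows "q\<^sup>*\<^sup>* (f x) (f y)"
  using assms(2) by induction (auto intro: assms(1) rtranclp.rtrancl_into_rtrancl)

lemma can_cdr_red: "can_red_s\<^sup>*\<^sup>* (Cdr p) (can_cdr p)"
  by (cases p) (auto intro: cctx_s_cctx_t.root_s cdr_rule.intros)

lemma can_car_red: "can_red\<^sup>*\<^sup>* (Car p) (can_car p)"
  unfolding can_red_def by (cases p) (auto intro: cctx_s_cctx_t.root_t car_rule.intros)

lemma can_reaches:
  shows "can_red_s\<^sup>*\<^sup>* p (can_s p)" and "can_red\<^sup>*\<^sup>* M (can_t M)"
proof (induction p and M)
  case (Cdr p)
  then have "can_red_s\<^sup>*\<^sup>* (Cdr p) (Cdr (can_s p))"
    by (rule rtranclp_map[rotated]) (rule cctx_s_cctx_t.cdr)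
  then show ?case using can_cdr_red[of "can_s p"] by simp
next
  case (ConsS M p)
  have "can_red_s\<^sup>*\<^sup>* (M ::: p) (can_t M ::: p)"
    using ConsS(1) unfolding can_red_def by (rule rtranclp_map[rotated]) (rule cctx_s_cctx_t.cons_l)
  also have "can_red_s\<^sup>*\<^sup>* (can_t M ::: p) (can_t M ::: can_s p)"
    using ConsS(2) by (rule rtranclp_map[rotated]) (rule cctx_s_cctx_t.cons_r)
  finally show ?case by simp
next
  case (Car p)
  then have "can_red\<^sup>*\<^sup>* (Car p) (Car (can_s p))"
    unfolding can_red_def by (rule rtranclp_map[rotated]) (rule cctx_s_cctx_t.car)
  then show ?case using can_car_red[of "can_s p"] by simp
next
  case (Mu M)
  then show ?case
    unfolding can_red_def can_t.simps by (rule rtranclp_map[rotated]) (rule cctx_s_cctx_t.mu)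
next
  case (App M p)
  have "can_red\<^sup>*\<^sup>* (M \<star> p) (can_t M \<star> p)"
    using App(1) unfolding can_red_def by (rule rtranclp_map[rotated]) (rule cctx_s_cctx_t.app_l)
  also have "can_red\<^sup>*\<^sup>* (can_t M \<star> p) (can_t M \<star> can_s p)"
    using App(2) unfolding can_red_def by (rule rtranclp_map[rotated]) (rule cctx_s_cctx_t.app_r)
  finally show ?case by simp
qed simp_all

inductive_simps can_red_s_simps:
  "can_red_s NilS q" "can_red_s (Var i) q" "can_red_s (Cdr p) q" "can_red_s (M ::: p) q"

inductive_simps can_red_t_simps:
  "cctx_t cdr_rule car_rule (Car p) Q" "cctx_t cdr_rule car_rule (Mu M) Q"
  "cctx_t cdr_rule car_rule (M \<star> p) Q"

inductive_simps cdr_rule_simps: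
  "cdr_rule NilS q" "cdr_rule (Var i) q" "cdr_rule (Cdr p) q" "cdr_rule (M ::: p) q"

inductive_simps car_rule_simps: "car_rule (Car p) N" "car_rule (Mu M) N" "car_rule (M \<star> p) N"

lemmas can_red_simps =
  can_red_s_simps can_red_t_simps[folded can_red_def] cdr_rule_simps car_rule_simps can_red_def[symmetric]

lemma can_normal:
  shows "\<not> can_red_s (can_s p) q" and "\<not> can_red (can_t M) Q"
proof (induction p and M arbitrary: q and Q)
  case (Cdr p)
  then show ?case by (cases "can_s p") (simp_all add: can_red_simps)
next
  case (Car p)
  then show ?case by (cases "can_s p") (simp_all add: can_red_simps)
qed (simp_all add: can_red_simps)

text \<open>The normalizer is constant along car and cdr steps. This yields uniqueness of canonical
  forms with no separate confluence proof.\<close>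

lemma can_red_same_can:
  shows "can_red_s p q \<Longrightarrow> can_s p = can_s q" and "cctx_t cdr_rule car_rule M N \<Longrightarrow> can_t M = can_t N"
  by (induction rule: cctx_s_cctx_t.inducts) (auto simp: cdr_rule.simps car_rule.simps)

lemma can_red_star_same_can:
  shows "can_red_s\<^sup>*\<^sup>* p q \<Longrightarrow> can_s p = can_s q" and "can_red\<^sup>*\<^sup>* M N \<Longrightarrow> can_t M = can_t N"
  subgoal by (induction rule: rtranclp_induct) (auto dest: can_red_same_can)
  subgoal by (induction rule: rtranclp_induct) (auto simp: can_red_def dest: can_red_same_can)
  done

lemma can_t_normal: "\<nexists>Q. can_red P Q \<Longrightarrow> can_t P = P"
  using can_reaches(2)[of P] by (auto elim: converse_rtranclpE)

lemma can_form_iff: "can_form M P \<longleftrightarrow> P = can_t M"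
  unfolding can_form_def
  using can_reaches(2)[of M] can_normal(2)[of M] can_red_star_same_can(2)[of M P] can_t_normal[of P]
  by auto

section \<open>Compatibility of canonical forms with renaming and substitution\<close>

lemma can_red_ren:
  shows "can_red_s p q \<Longrightarrow> can_red_s (ren_s r p) (ren_s r q)"
    and "cctx_t cdr_rule car_rule M N \<Longrightarrow> cctx_t cdr_rule car_rule (ren_t r M) (ren_t r N)"
  by (induction arbitrary: r and r rule: cctx_s_cctx_t.inducts)
    (auto simp: cdr_rule.simps car_rule.simps intro: cctx_s_cctx_t.intros)

lemma can_red_sub:
  shows "can_red_s p q \<Longrightarrow> can_red_s (sub_s s p) (sub_s s q)"
    and "cctx_t cdr_rule car_rule M N \<Longrightarrow> cctx_t cdr_rule car_rule (sub_t s M) (sub_t s N)"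
  by (induction arbitrary: s and s rule: cctx_s_cctx_t.inducts)
    (auto simp: cdr_rule.simps car_rule.simps intro: cctx_s_cctx_t.intros)

lemma can_ren_can: "can_s (ren_s r (can_s p)) = can_s (ren_s r p)"
  by (rule can_red_star_same_can(1)[symmetric], rule rtranclp_map[OF _ can_reaches(1)])
    (rule can_red_ren)

lemma can_sub_can: "can_t (sub_t s (can_t M)) = can_t (sub_t s M)"
  by (rule can_red_star_same_can(2)[symmetric], rule rtranclp_map[OF _ can_reaches(2)])
    (simp add: can_red_def can_red_sub)

lemma can_up_sub_cong:
  assumes "\<And>i. can_s (s i) = can_s (s' i)"
  shows "can_s (up_sub s i) = can_s (up_sub s' i)"
proof (cases i)
  case (Suc j)
  then show ?thesis using assms[of j] can_ren_can by (metis up_sub_simps(2))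
qed simp

lemma can_sub_cong:
  shows "(\<And>i. can_s (s i) = can_s (s' i)) \<Longrightarrow> can_s (sub_s s p) = can_s (sub_s s' p)"
    and "(\<And>i. can_s (s i) = can_s (s' i)) \<Longrightarrow> can_t (sub_t s M) = can_t (sub_t s' M)"
proof (induction p and M arbitrary: s s' and s s')
  case (Mu M)
  show ?case
    using Mu.IH[of "up_sub s" "up_sub s'"] can_up_sub_cong[OF Mu.prems] by simp
next
  case (Cdr p)
  show ?case using Cdr.IH[OF Cdr.prems] by simp
next
  case (ConsS M p)
  show ?case using ConsS.IH(1)[OF ConsS.prems] ConsS.IH(2)[OF ConsS.prems] by simp
next
  case (Car p)
  show ?case using Car.IH[OF Car.prems] by simp
next
  case (App M p)
  show ?case using App.IH(1)[OF App.prems] App.IH(2)[OF App.prems] by simp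
qed simp_all

lemma can_s_idem: "can_s (can_s p) = can_s p"
  using can_red_star_same_can(1)[OF can_reaches(1)] by simp

text \<open>Head reduction instantiates the canonicalized body with a canonicalized stack; up to
  canonical form this agrees with instantiating the original ones.\<close>

lemma can_inst_can: "can_t (inst (can_t M) (can_s p)) = can_t (inst M p)"
proof -
  have "can_t (inst (can_t M) (can_s p)) = can_t (sub_t (case_nat (can_s p) Var) M)"
    by (simp add: inst_def can_sub_can)
  also have "\<dots> = can_t (inst M p)"
    unfolding inst_def by (rule can_sub_cong) (simp add: can_s_idem split: nat.split)
  finally show ?thesis .
qed

lemma can_apps: "can_t (apps M ps) = apps (can_t M) (map can_s ps)"
  unfolding apps_def by (induction ps arbitrary: M) simp_all

lemma apps_snoc: "apps M (ps @ [p]) = apps M ps \<star> p"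
  by (simp add: apps_def)

section \<open>Terms with a proper head normal form\<close>

definition has_proper_hnf :: "trm \<Rightarrow> bool" where
  "has_proper_hnf M \<longleftrightarrow> (\<exists>P. head_red\<^sup>*\<^sup>* M P \<and> proper_hnf P)"

lemma head_red_same_can: "can_t M = can_t N \<Longrightarrow> M \<rightarrow>\<^sub>h P \<longleftrightarrow> N \<rightarrow>\<^sub>h P"
  by (simp add: head_red.simps can_form_iff)

text \<open>Both the first head step and properness depend on a term only through its canonical
  form, so a reduction from \<open>M\<close> can start from \<open>N\<close> instead.\<close>

lemma has_proper_hnf_same_can:
  assumes "can_t M = can_t N" and "has_proper_hnf M"
  shows "has_proper_hnf N"
proof -
  obtain P where P: "head_red\<^sup>*\<^sup>* M P" "proper_hnf P"
    using assms(2) by (auto simp: has_proper_hnf_def)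
  from P(1) show ?thesis
  proof (cases rule: converse_rtranclpE)
    case base
    then have "proper_hnf N"
      using P(2) assms(1) head_red_same_can[OF assms(1)]
      by (simp add: proper_hnf_def hnf_def can_form_iff)
    then show ?thesis by (auto simp: has_proper_hnf_def)
  next
    case (step Q)
    then show ?thesis
      using head_red_same_can[OF assms(1)] P(2)
      by (metis has_proper_hnf_def converse_rtranclp_into_rtranclp)
  qed
qed

text \<open>The head step acts on the canonical form, so its result is only equal to the given
  contractum up to car and cdr steps.\<close>

lemma has_proper_hnf_head_expansion:
  assumes "has_proper_hnf (apps (inst M p) ps)"
  shows "has_proper_hnf (apps (Mu M \<star> p) ps)"
proof -
  let ?P = "apps (inst (can_t M) (can_s p)) (map can_s ps)"
  have "can_form (apps (Mu M \<star> p) ps) (mus 0 (apps (Mu (can_t M) \<star> can_s p) (map can_s ps)))"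
    by (simp add: can_form_iff can_apps mus_def)
  from head_red.intros[OF this] have "apps (Mu M \<star> p) ps \<rightarrow>\<^sub>h ?P"
    by (simp add: mus_def)
  moreover have "has_proper_hnf ?P"
    by (rule has_proper_hnf_same_can[OF _ assms]) (simp add: can_apps can_inst_can comp_def can_s_idem)
  ultimately show ?thesis
    by (meson has_proper_hnf_def converse_rtranclp_into_rtranclp)
qed

lemma can_cdrs_Var: "can_s ((Cdr ^^ n) (Var b)) = (Cdr ^^ n) (Var b)"
proof (induction n)
  case (Suc n)
  then show ?case by (cases n) simp_all
qed simp

lemma can_car_n_Var: "can_t (car_n n (Var b)) = car_n n (Var b)"
  unfolding car_n_def using can_cdrs_Var[of n b] by (cases n) simp_all

text \<open>An invariant that tells a term headed by \<open>Car\<close> from one that is an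
  abstraction or has a beta redex at its head.\<close>

primrec spine_head :: "trm \<Rightarrow> trm" where
  "spine_head (Car p) = Car p"
| "spine_head (Mu M) = Mu M"
| "spine_head (M \<star> p) = spine_head M"

lemma spine_head_apps: "spine_head (apps M ps) = spine_head M"
  unfolding apps_def by (induction ps arbitrary: M) simp_all

lemma has_proper_hnf_var: "has_proper_hnf (apps (car_n n (Var b)) ps)"
proof -
  let ?M = "apps (car_n n (Var b)) ps"
  have can: "can_t ?M = apps (car_n n (Var b)) (map can_s ps)"
    by (simp add: can_apps can_car_n_Var)
  have "False" if eq: "mus k (apps (Mu N \<star> w) qs) = can_t ?M" for k N w qs
  proof -
    have head: "spine_head (can_t ?M) = Car ((Cdr ^^ n) (Var b))"
      unfolding can spine_head_apps by (simp add: car_n_def)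
    show False
      \<comment> \<open>For \<open>k = 0\<close> the spine head is \<open>Mu N\<close>, and for
        \<open>k > 0\<close> the whole term is a \<open>Mu\<close>; neither is a
        \<open>Car\<close>.\<close>
      using head unfolding eq[symmetric] by (cases k) (simp_all add: mus_def spine_head_apps)
  qed
  then have "hnf ?M"
    by (auto simp: hnf_def head_red.simps can_form_iff)
  moreover have "can_form ?M (mus 0 (apps (car_n n (Var b)) (map can_s ps)))"
    by (simp add: can_form_iff can mus_def)
  ultimately have "proper_hnf ?M"
    unfolding proper_hnf_def by blast
  then show ?thesis
    by (auto simp: has_proper_hnf_def)
qed

section \<open>The graph model\<close>

text \<open>The source of an arrow lists pairs \<open>(n, t)\<close>: component \<open>n\<close> of the stack must have type \<open>t\<close>.\<close>

datatype ty = Ground | Arr "(nat \<times> ty) list" ty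

type_synonym den = "nat \<Rightarrow> ty set"

text \<open>The least stack denotation that meets the requirements in \<open>F\<close>; these are
  the finite elements of the model.\<close>

definition den_of :: "(nat \<times> ty) list \<Rightarrow> den" where
  "den_of F n = {t. (n, t) \<in> set F}"

lemma den_of_le_iff: "den_of F \<le> d \<longleftrightarrow> (\<forall>(n, t)\<in>set F. t \<in> d n)"
  by (auto simp: den_of_def le_fun_def)

text \<open>A graph model in the style of Engeler: an abstraction denotes the trace of a function on
  finite stack denotations, and application looks for a finite part of the argument that some arrow
  accepts.\<close>

primrec sem_s :: "stk \<Rightarrow> (nat \<Rightarrow> den) \<Rightarrow> den" and sem_t :: "trm \<Rightarrow> (nat \<Rightarrow> den) \<Rightarrow> ty set" where
  "sem_s NilS \<rho> = (\<lambda>n. {})"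
| "sem_s (Var i) \<rho> = \<rho> i"
| "sem_s (Cdr p) \<rho> = (\<lambda>n. sem_s p \<rho> (Suc n))"
| "sem_s (M ::: p) \<rho> = case_nat (sem_t M \<rho>) (sem_s p \<rho>)"
| "sem_t (Car p) \<rho> = sem_s p \<rho> 0"
| "sem_t (Mu M) \<rho> = {Arr F a | F a. a \<in> sem_t M (case_nat (den_of F) \<rho>)}"
| "sem_t (M \<star> p) \<rho> = {a. \<exists>F. Arr F a \<in> sem_t M \<rho> \<and> den_of F \<le> sem_s p \<rho>}"

lemma case_nat_comp_up_ren: "case_nat d \<rho> \<circ> up_ren r = case_nat d (\<rho> \<circ> r)"
  by (rule ext) (simp add: up_ren_def split: nat.split)

lemma sem_ren:
  shows "sem_s (ren_s r p) \<rho> = sem_s p (\<rho> \<circ> r)" and "sem_t (ren_t r M) \<rho> = sem_t M (\<rho> \<circ> r)"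
  by (induction p and M arbitrary: r \<rho> and r \<rho>) (simp_all add: case_nat_comp_up_ren)

lemma sem_up_sub:
  "(\<lambda>i. sem_s (up_sub s i) (case_nat d \<rho>)) = case_nat d (\<lambda>i. sem_s (s i) \<rho>)"
proof
  fix i
  show "sem_s (up_sub s i) (case_nat d \<rho>) = case_nat d (\<lambda>i. sem_s (s i) \<rho>) i"
    by (cases i) (simp_all add: sem_ren comp_def)
qed

lemma sem_sub:
  shows "sem_s (sub_s s p) \<rho> = sem_s p (\<lambda>i. sem_s (s i) \<rho>)"
    and "sem_t (sub_t s M) \<rho> = sem_t M (\<lambda>i. sem_s (s i) \<rho>)"
  by (induction p and M arbitrary: s \<rho> and s \<rho>) (simp_all add: sem_up_sub)

lemma sem_inst: "sem_t (inst M p) \<rho> = sem_t M (case_nat (sem_s p \<rho>) \<rho>)"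
proof -
  have "(\<lambda>i. sem_s (case_nat p Var i) \<rho>) = case_nat (sem_s p \<rho>) \<rho>"
    by (rule ext) (simp split: nat.split)
  then show ?thesis by (simp add: inst_def sem_sub)
qed

lemma le_case_nat_iff: "f \<le> case_nat d g \<longleftrightarrow> f 0 \<le> d \<and> f \<circ> Suc \<le> g"
  for d :: "'a :: order"
  unfolding le_fun_def by (metis comp_apply nat.case(1,2) not0_implies_Suc)

lemma case_nat_mono: "d \<le> d' \<Longrightarrow> g \<le> g' \<Longrightarrow> case_nat d g \<le> case_nat d' g'"
  for d d' :: "'a :: order"
  unfolding le_case_nat_iff by (simp add: comp_def)

section \<open>Monotonicity and continuity of the denotation\<close>

lemma sem_mono:
  shows "\<rho> \<le> \<rho>' \<Longrightarrow> sem_s p \<rho> \<le> sem_s p \<rho>'" and "\<rho> \<le> \<rho>' \<Longrightarrow> sem_t M \<rho> \<subseteq> sem_t M \<rho>'"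
proof (induction p and M arbitrary: \<rho> \<rho>' and \<rho> \<rho>')
  case (ConsS M p)
  show ?case
    unfolding sem_s.simps
    by (rule case_nat_mono[OF ConsS.IH(1)[OF ConsS.prems] ConsS.IH(2)[OF ConsS.prems]])
next
  case (Mu M)
  have "sem_t M (case_nat (den_of F) \<rho>) \<subseteq> sem_t M (case_nat (den_of F) \<rho>')" for F
    by (rule Mu.IH) (rule case_nat_mono[OF order_refl Mu.prems])
  then show ?case by auto
next
  case (App M p)
  show ?case
    using App.IH(1)[OF App.prems] App.IH(2)[OF App.prems] by (auto intro: order_trans)
qed (simp_all add: le_fun_def)

text \<open>Finiteness is asked of each variable separately, just enough to list the denotation of
  one variable as the source of an arrow.\<close>

definition fin_env :: "(nat \<Rightarrow> den) \<Rightarrow> bool" where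
  "fin_env \<rho> \<longleftrightarrow> (\<forall>i. finite {(n, t). t \<in> \<rho> i n})"

lemma fin_env_sup: "fin_env \<rho> \<Longrightarrow> fin_env \<rho>' \<Longrightarrow> fin_env (sup \<rho> \<rho>')"
proof -
  have "{(n, t). t \<in> sup \<rho> \<rho>' i n} = {(n, t). t \<in> \<rho> i n} \<union> {(n, t). t \<in> \<rho>' i n}" for i
    by auto
  then show "fin_env \<rho> \<Longrightarrow> fin_env \<rho>' \<Longrightarrow> fin_env (sup \<rho> \<rho>')"
    by (simp add: fin_env_def)
qed

lemma fin_env_empty: "fin_env (\<lambda>_ _. {})"
  by (simp add: fin_env_def)

lemma fin_env_den_of:
  assumes "fin_env \<rho>"
  obtains F where "den_of F = \<rho> i"
proof -
  obtain F where "set F = {(n, t). t \<in> \<rho> i n}"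
    using assms finite_list unfolding fin_env_def by blast
  then have "den_of F = \<rho> i" by (auto simp: den_of_def fun_eq_iff)
  then show ?thesis by (rule that)
qed

text \<open>Only finitely many requirements have to be met, so the join of the finite environments
  chosen for each of them works.\<close>

lemma fin_env_den_of_bound:
  assumes "\<And>n t. (n, t) \<in> set F \<Longrightarrow> \<exists>\<rho>'. \<rho>' \<le> \<rho> \<and> fin_env \<rho>' \<and> t \<in> sem_s p \<rho>' n"
  shows "\<exists>\<rho>'. \<rho>' \<le> \<rho> \<and> fin_env \<rho>' \<and> den_of F \<le> sem_s p \<rho>'"
  using assms
proof (induction F)
  case Nil
  show ?case
    by (rule exI[of _ "\<lambda>_ _. {}"]) (simp add: fin_env_empty den_of_le_iff, simp add: le_fun_def)
next
  case (Cons x F)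
  obtain n t where x: "x = (n, t)" by fastforce
  obtain \<rho>1 where 1: "\<rho>1 \<le> \<rho>" "fin_env \<rho>1" "den_of F \<le> sem_s p \<rho>1"
    using Cons by auto
  obtain \<rho>2 where 2: "\<rho>2 \<le> \<rho>" "fin_env \<rho>2" "t \<in> sem_s p \<rho>2 n"
    using Cons.prems[of n t] x by auto
  have "sem_s p \<rho>1 \<le> sem_s p (sup \<rho>1 \<rho>2)" "sem_s p \<rho>2 \<le> sem_s p (sup \<rho>1 \<rho>2)"
    by (rule sem_mono(1)[OF sup_ge1], rule sem_mono(1)[OF sup_ge2])
  then have "den_of F \<le> sem_s p (sup \<rho>1 \<rho>2)" "t \<in> sem_s p (sup \<rho>1 \<rho>2) n"
    using 1(3) 2(3) by (auto dest: le_funD)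
  then have "den_of (x # F) \<le> sem_s p (sup \<rho>1 \<rho>2)"
    using x by (simp add: den_of_le_iff)
  then show ?case
    using 1(1,2) 2(1,2) by (intro exI[of _ "sup \<rho>1 \<rho>2"] conjI le_supI fin_env_sup)
qed

text \<open>A single type assignment consults only finitely much of the environment.\<close>

lemma sem_continuous:
  shows "t \<in> sem_s p \<rho> n \<Longrightarrow> \<exists>\<rho>'. \<rho>' \<le> \<rho> \<and> fin_env \<rho>' \<and> t \<in> sem_s p \<rho>' n"
    and "t \<in> sem_t M \<rho> \<Longrightarrow> \<exists>\<rho>'. \<rho>' \<le> \<rho> \<and> fin_env \<rho>' \<and> t \<in> sem_t M \<rho>'"
proof (induction p and M arbitrary: t \<rho> n and t \<rho>)
  case (Var i)
  let ?\<rho>' = "\<lambda>j m. if j = i \<and> m = n then {t} else {}"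
  have "finite {(m, u). u \<in> ?\<rho>' j m}" for j
    by (rule finite_subset[of _ "{(n, t)}"]) (auto split: if_splits)
  then show ?case
    using Var by (intro exI[of _ ?\<rho>']) (auto simp: fin_env_def le_fun_def)
next
  case (ConsS M p)
  then show ?case by (cases n) simp_all
next
  case (Mu M)
  then obtain F a where t: "t = Arr F a" "a \<in> sem_t M (case_nat (den_of F) \<rho>)"
    by auto
  then obtain \<rho>' where *: "\<rho>' \<le> case_nat (den_of F) \<rho>" "fin_env \<rho>'" "a \<in> sem_t M \<rho>'"
    using Mu.IH by blast
  \<comment> \<open>The finite environment may give the bound variable less than
    \<open>den_of F\<close>; monotonicity restores the full source, so that \<open>Arr F a\<close>
    is obtained.\<close>
  have "\<rho>' \<le> case_nat (den_of F) (\<rho>' \<circ> Suc)" and le: "\<rho>' \<circ> Suc \<le> \<rho>"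
    using *(1) unfolding le_case_nat_iff by blast+
  then have "a \<in> sem_t M (case_nat (den_of F) (\<rho>' \<circ> Suc))"
    using *(3) sem_mono(2) by blast
  moreover have "fin_env (\<rho>' \<circ> Suc)"
    using *(2) by (simp add: fin_env_def)
  ultimately show ?case
    using t(1) le by auto
next
  case (App M p)
  then obtain F where F: "Arr F t \<in> sem_t M \<rho>" "den_of F \<le> sem_s p \<rho>"
    by auto
  obtain \<rho>1 where 1: "\<rho>1 \<le> \<rho>" "fin_env \<rho>1" "Arr F t \<in> sem_t M \<rho>1"
    using App.IH(1)[OF F(1)] by blast
  have "\<exists>\<rho>'. \<rho>' \<le> \<rho> \<and> fin_env \<rho>' \<and> den_of F \<le> sem_s p \<rho>'"
    using F(2) by (intro fin_env_den_of_bound App.IH(2)) (auto simp: den_of_le_iff)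
  then obtain \<rho>2 where 2: "\<rho>2 \<le> \<rho>" "fin_env \<rho>2" "den_of F \<le> sem_s p \<rho>2"
    by blast
  have "Arr F t \<in> sem_t M (sup \<rho>1 \<rho>2)" "den_of F \<le> sem_s p (sup \<rho>1 \<rho>2)"
    using subsetD[OF sem_mono(2)[OF sup_ge1] 1(3)] order_trans[OF 2(3) sem_mono(1)[OF sup_ge2]] .
  then have "t \<in> sem_t (M \<star> p) (sup \<rho>1 \<rho>2)"
    unfolding sem_t.simps by blast
  then show ?case
    using 1(1,2) 2(1,2) by (intro exI[of _ "sup \<rho>1 \<rho>2"] conjI le_supI fin_env_sup)
qed auto

text \<open>Reducing is sound by monotonicity. Expanding needs continuity: the finite part of the
  stack that is used can be listed as the source of an arrow.\<close>

lemma sem_beta: "sem_t (Mu M \<star> p) = sem_t (inst M p)"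
proof (intro ext set_eqI iffI)
  fix \<rho> a
  assume "a \<in> sem_t (Mu M \<star> p) \<rho>"
  then obtain F where "a \<in> sem_t M (case_nat (den_of F) \<rho>)" "den_of F \<le> sem_s p \<rho>"
    by auto
  then show "a \<in> sem_t (inst M p) \<rho>"
    using sem_mono(2)[OF case_nat_mono] by (fastforce simp: sem_inst)
next
  fix \<rho> a
  assume "a \<in> sem_t (inst M p) \<rho>"
  then obtain \<rho>' where *: "\<rho>' \<le> case_nat (sem_s p \<rho>) \<rho>" "fin_env \<rho>'" "a \<in> sem_t M \<rho>'"
    using sem_continuous(2) by (fastforce simp: sem_inst)
  obtain F where F: "den_of F = \<rho>' 0"
    using fin_env_den_of[OF *(2)] .
  have "\<rho>' \<le> case_nat (den_of F) \<rho>" and le: "den_of F \<le> sem_s p \<rho>"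
    using *(1) unfolding F le_case_nat_iff by blast+
  then have "a \<in> sem_t M (case_nat (den_of F) \<rho>)"
    using *(3) sem_mono(2) by blast
  then show "a \<in> sem_t (Mu M \<star> p) \<rho>"
    using le by auto
qed

section \<open>Invariance of the denotation under reduction\<close>

lemma sem_cctx:
  assumes "\<And>p q. S p q \<Longrightarrow> sem_s p = sem_s q" and "\<And>M N. R M N \<Longrightarrow> sem_t M = sem_t N"
  shows "cctx_s S R p q \<Longrightarrow> sem_s p = sem_s q" and "cctx_t S R M N \<Longrightarrow> sem_t M = sem_t N"
  by (induction rule: cctx_s_cctx_t.inducts) ((rule ext, simp add: assms)+)

lemma sem_cdr_rule: "cdr_rule p q \<Longrightarrow> sem_s p = sem_s q"
  by (auto simp: cdr_rule.simps fun_eq_iff)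

lemma sem_car_rule: "car_rule M N \<Longrightarrow> sem_t M = sem_t N"
  by (auto simp: car_rule.simps fun_eq_iff)

lemma sem_red: "red M N \<Longrightarrow> sem_t M = sem_t N"
  unfolding red_def
  by (rule sem_cctx(2)) (auto simp: sem_cdr_rule sem_car_rule mu_rule.simps sem_beta)

lemma sem_eq_s: "M =\<^sub>s N \<Longrightarrow> sem_t M = sem_t N"
  unfolding eq_s_def by (induction rule: equivclp_induct) (auto dest: sem_red)

lemma sem_can_red: "can_red M N \<Longrightarrow> sem_t M = sem_t N"
  unfolding can_red_def by (rule sem_cctx(2)) (auto simp: sem_cdr_rule sem_car_rule)

lemma sem_can_form:
  assumes "can_form M P"
  shows "sem_t P = sem_t M"
proof -
  have "can_red\<^sup>*\<^sup>* M P" using assms by (simp add: can_form_def)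
  then show ?thesis by induction (auto dest: sem_can_red)
qed

lemma sem_app_cong: "sem_t M = sem_t N \<Longrightarrow> sem_t (M \<star> p) = sem_t (N \<star> p)"
  by (rule ext) simp

lemma sem_apps_cong: "sem_t M = sem_t N \<Longrightarrow> sem_t (apps M ps) = sem_t (apps N ps)"
  by (induction ps rule: rev_induct) (simp add: apps_def, metis apps_snoc sem_app_cong)

lemma sem_mus_cong: "sem_t M = sem_t N \<Longrightarrow> sem_t (mus k M) = sem_t (mus k N)"
  unfolding mus_def by (induction k) (simp, rule ext, simp)

lemma sem_head_red:
  assumes "M \<rightarrow>\<^sub>h N"
  shows "sem_t M = sem_t N"
  using assms
proof cases
  case (1 k L w ps)
  have "sem_t M = sem_t (mus k (apps (Mu L \<star> w) ps))"
    using sem_can_form[OF 1(2)] by simp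
  also have "\<dots> = sem_t (mus k (apps (inst L w) ps))"
    by (intro sem_mus_cong sem_apps_cong sem_beta)
  finally show ?thesis using 1(1) by simp
qed

lemma sem_head_red_star: "head_red\<^sup>*\<^sup>* M N \<Longrightarrow> sem_t M = sem_t N"
  by (induction rule: rtranclp_induct) (auto dest: sem_head_red)

section \<open>Typability and proper head normal forms\<close>

text \<open>An arrow with empty source accepts every stack, even one whose components have no
  type.\<close>

lemma sem_apps_intro:
  "(Arr [] ^^ length ps) a \<in> sem_t M \<rho> \<Longrightarrow> a \<in> sem_t (apps M ps) \<rho>"
proof (induction ps arbitrary: a rule: rev_induct)
  case (snoc p ps)
  then have "Arr [] a \<in> sem_t (apps M ps) \<rho>"
    by (simp add: funpow_swap1)
  then show ?case
    by (auto simp: apps_snoc den_of_le_iff intro!: exI[of _ "[]"])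
qed (simp add: apps_def)

text \<open>Each abstraction moves the denotation of variable \<open>0\<close> into the source of an
  arrow, hence the change of environment. Continuity first makes that denotation finite.\<close>

lemma sem_mus_nonempty: "sem_t M \<rho> \<noteq> {} \<Longrightarrow> \<exists>\<rho>'. sem_t (mus k M) \<rho>' \<noteq> {}"
proof (induction k)
  case (Suc k)
  then obtain \<rho>' a where "a \<in> sem_t (mus k M) \<rho>'" by auto
  then obtain \<rho>' where *: "fin_env \<rho>'" "a \<in> sem_t (mus k M) \<rho>'"
    using sem_continuous(2) by blast
  obtain F where F: "den_of F = \<rho>' 0"
    using fin_env_den_of[OF *(1)] .
  have "\<rho>' = case_nat (den_of F) (\<rho>' \<circ> Suc)"
    by (rule ext) (simp add: F split: nat.split)
  with *(2) have "Arr F a \<in> sem_t (Mu (mus k M)) (\<rho>' \<circ> Suc)"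
    by simp
  then show ?case by (auto simp: mus_def)
qed (auto simp: mus_def)

lemma sem_cdrs: "sem_s ((Cdr ^^ n) p) \<rho> m = sem_s p \<rho> (n + m)"
  by (induction n arbitrary: m) simp_all

lemma sem_car_n: "sem_t (car_n n p) \<rho> = sem_s p \<rho> n"
  by (simp add: car_n_def sem_cdrs)

lemma has_proper_hnf_typable:
  assumes "has_proper_hnf M"
  shows "\<exists>\<rho>. sem_t M \<rho> \<noteq> {}"
proof -
  obtain P k n b ps where P: "head_red\<^sup>*\<^sup>* M P" "can_form P (mus k (apps (car_n n (Var b)) ps))"
    using assms by (auto simp: has_proper_hnf_def proper_hnf_def)
  \<comment> \<open>Here the head variable has every type, in particular the chain of empty arrows
    ending in \<open>Ground\<close>.\<close>
  have "sem_t (apps (car_n n (Var b)) ps) (\<lambda>_ _. UNIV) \<noteq> {}"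
    using sem_apps_intro[of ps Ground "car_n n (Var b)" "\<lambda>_ _. UNIV"] by (auto simp: sem_car_n)
  from sem_mus_nonempty[OF this, of k] show ?thesis
    using sem_head_red_star[OF P(1)] sem_can_form[OF P(2)] by simp
qed

section \<open>Realizability\<close>

text \<open>A logical predicate whose ground case is the property to be proved. A stack is tested
  through its components \<open>car_n\<close>, to match the sources of arrows.\<close>

function realizes :: "ty \<Rightarrow> trm \<Rightarrow> bool" where
  "realizes Ground M \<longleftrightarrow> has_proper_hnf M"
| "realizes (Arr F a) M \<longleftrightarrow>
    (\<forall>p. (\<forall>x\<in>set F. realizes (snd x) (car_n (fst x) p)) \<longrightarrow> realizes a (M \<star> p))"
  by pat_completeness auto
termination
proof (relation "measure (size \<circ> fst)")
  fix F :: "(nat \<times> ty) list" and a M p x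
  assume "x \<in> set F"
  \<comment> \<open>Termination: the size of an arrow type bounds the sizes of the types nested in
    its source list.\<close>
  then have "size (snd x) \<le> size_list (size_prod (\<lambda>_. 0) size) F"
    by (intro size_list_estimation'[of x]) (auto simp: size_prod_def split: prod.splits)
  then show "((snd x, car_n (fst x) p), Arr F a, M) \<in> measure (size \<circ> fst)"
    by simp
qed auto

lemma realizes_same_can: "can_t M = can_t N \<Longrightarrow> realizes a M \<Longrightarrow> realizes a N"
proof (induction a arbitrary: M N)
  case Ground
  then show ?case unfolding realizes.simps by (rule has_proper_hnf_same_can)
next
  case (Arr F a)
  show ?case
    unfolding realizes.simps
  proof (intro allI impI)
    fix p
    assume "\<forall>x\<in>set F. realizes (snd x) (car_n (fst x) p)"
    then have "realizes a (M \<star> p)" using Arr.prems(2) by simp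
    then show "realizes a (N \<star> p)" by (rule Arr.IH(2)[rotated]) (simp add: Arr.prems(1))
  qed
qed

text \<open>The trailing stacks \<open>ps\<close> make the induction pass: an arrow type appends one
  more stack.\<close>

lemma realizes_head_expansion:
  "realizes a (apps (inst M p) ps) \<Longrightarrow> realizes a (apps (Mu M \<star> p) ps)"
proof (induction a arbitrary: ps)
  case Ground
  then show ?case by (simp add: has_proper_hnf_head_expansion)
next
  case (Arr F a)
  then show ?case by (simp flip: apps_snoc)
qed

text \<open>A variable in head position gives a proper head normal form whatever its arguments, so
  the arrow case asks nothing of the stack.\<close>

lemma realizes_var: "realizes a (apps (car_n n (Var b)) ps)"
proof (induction a arbitrary: ps)
  case Ground
  then show ?case by (simp add: has_proper_hnf_var)
next
  case (Arr F a)
  then show ?case by (simp flip: apps_snoc)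
qed

lemma can_car_n_Cons: "can_t (car_n (Suc n) (M ::: p)) = can_t (car_n n p)"
proof -
  have "can_s ((Cdr ^^ Suc n) (M ::: p)) = can_s ((Cdr ^^ n) p)"
    by (induction n) simp_all
  then show ?thesis by (simp add: car_n_def)
qed

text \<open>Adequacy: under a substitution that realizes the environment, terms realize their types
  and stacks do so componentwise.\<close>

lemma sem_realizes:
  shows "(\<And>i m u. u \<in> \<rho> i m \<Longrightarrow> realizes u (car_n m (s i))) \<Longrightarrow>
      t \<in> sem_s p \<rho> n \<Longrightarrow> realizes t (car_n n (sub_s s p))"
    and "(\<And>i m u. u \<in> \<rho> i m \<Longrightarrow> realizes u (car_n m (s i))) \<Longrightarrow>
      t \<in> sem_t M \<rho> \<Longrightarrow> realizes t (sub_t s M)"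
proof (induction p and M arbitrary: \<rho> s t n and \<rho> s t)
  case (Cdr p)
  have "realizes t (car_n (Suc n) (sub_s s p))"
    using Cdr.prems(2) by (intro Cdr.IH[OF Cdr.prems(1)]) simp_all
  then show ?case by (simp add: car_n_def funpow_swap1)
next
  case (ConsS M p)
  show ?case
  proof (cases n)
    case 0
    then have "realizes t (sub_t s M)" using ConsS.IH(1)[OF ConsS.prems(1)] ConsS.prems(2) by simp
    \<comment> \<open>\<open>car_n 0\<close> of a cons is a car redex, so it has the same canonical
      form as its contractum.\<close>
    then show ?thesis
      using 0 by (auto intro: realizes_same_can[rotated] simp: car_n_def)
  next
    case (Suc m)
    then have "realizes t (car_n m (sub_s s p))" using ConsS.IH(2)[OF ConsS.prems(1)] ConsS.prems(2) by simp
    then show ?thesis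
      using Suc can_car_n_Cons by (auto intro: realizes_same_can[rotated])
  qed
next
  case (Car p)
  have "realizes t (car_n 0 (sub_s s p))"
    using Car.prems(2) by (intro Car.IH[OF Car.prems(1)]) simp_all
  then show ?case by (simp add: car_n_def)
next
  case (Mu M)
  then obtain F a where t: "t = Arr F a" "a \<in> sem_t M (case_nat (den_of F) \<rho>)" by auto
  have "realizes a (sub_t s (Mu M) \<star> q)"
    if q: "\<forall>x\<in>set F. realizes (snd x) (car_n (fst x) q)" for q
  proof -
    have "realizes u (car_n m (case_nat q s i))" if "u \<in> case_nat (den_of F) \<rho> i m" for i m u
      using that q Mu.prems(1) by (cases i) (auto simp: den_of_def)
    then have "realizes a (sub_t (case_nat q s) M)"
      using Mu.IH t(2) by blast
    then show ?thesis
      using realizes_head_expansion[of a _ q "[]"] by (simp add: apps_def inst_sub_up)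
  qed
  then show ?case using t(1) by simp
next
  case (App M p)
  then obtain F where F: "Arr F t \<in> sem_t M \<rho>" "den_of F \<le> sem_s p \<rho>" by auto
  have "realizes (Arr F t) (sub_t s M)" using App.IH(1)[OF App.prems(1) F(1)] by simp
  moreover have "realizes (snd x) (car_n (fst x) (sub_s s p))" if "x \<in> set F" for x
  proof -
    have "snd x \<in> sem_s p \<rho> (fst x)"
      using F(2) that by (auto simp: den_of_le_iff)
    then show ?thesis using App.IH(2)[OF App.prems(1)] by simp
  qed
  ultimately show ?case by simp
qed (simp_all add: car_n_def)

text \<open>Variables realize every type, so the identity substitution realizes any environment and
  adequacy applies to \<open>M\<close> itself.\<close>

lemma ground_has_proper_hnf:
  assumes "Ground \<in> sem_t M \<rho>"
  shows "has_proper_hnf M"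
proof -
  have "realizes u (car_n m (Var i))" for u m i
    using realizes_var[of u m i "[]"] by (simp add: apps_def)
  then have "realizes Ground (sub_t Var M)"
    using sem_realizes(2)[OF _ assms] by blast
  then show ?thesis by (simp add: sub_Var)
qed

section \<open>Separable terms are observably different\<close>

lemma sem_TT: "sem_t (TT \<star> (M ::: N ::: p)) = sem_t (M \<star> p)"
  unfolding TT_def sem_beta
  by (rule ext) (simp add: sem_inst sem_car_n sem_cdrs numeral_2_eq_2)

lemma sem_FF: "sem_t (FF \<star> (M ::: N ::: p)) = sem_t (N \<star> p)"
  unfolding FF_def sem_beta
  by (rule ext) (simp add: sem_inst sem_car_n sem_cdrs numeral_2_eq_2)

theorem theorem6:
  fixes M N :: trm
  assumes "separable M N"
  shows "\<not> M \<simeq> N"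
proof
  assume "M \<simeq> N"
  obtain C where C: "fill C M =\<^sub>s TT" "fill C N =\<^sub>s FF"
    using assms by (auto simp: separable_def)
  \<comment> \<open>\<open>TT\<close> selects the first entry, with a variable head, and
    \<open>FF\<close> the second, headed by \<open>nil\<close> and hence without types.\<close>
  let ?p = "Car (Var 0) ::: Car NilS ::: NilS"
  have "sem_t (fill C M \<star> ?p) = sem_t (Car (Var 0) \<star> NilS)"
    using sem_app_cong[OF sem_eq_s[OF C(1)]] sem_TT by (rule trans)
  moreover have "Ground \<in> sem_t (Car (Var 0) \<star> NilS) (\<lambda>_ _. UNIV)"
    by (auto simp: den_of_le_iff intro!: exI[of _ "[]"])
  ultimately have "has_proper_hnf (fill C M \<star> ?p)"
    by (intro ground_has_proper_hnf) (simp only:)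
  \<comment> \<open>Appending a stack to \<open>C\<close> gives another head context, to which
    observational equivalence applies.\<close>
  then have "has_proper_hnf (fill (CApp C ?p) N)"
    using \<open>M \<simeq> N\<close> unfolding obs_eq_def has_proper_hnf_def by (metis fill.simps(2))
  then obtain \<rho> where "sem_t (fill C N \<star> ?p) \<rho> \<noteq> {}"
    using has_proper_hnf_typable by fastforce
  moreover have "sem_t (fill C N \<star> ?p) = sem_t (Car NilS \<star> NilS)"
    using sem_app_cong[OF sem_eq_s[OF C(2)]] sem_FF by (rule trans)
  ultimately show False by simp
qed

end
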